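(* Let $\alpha>-1$ and $\beta>0$. Let $f\in\mathcal{B}_{\mathcal{H}}^0(\alpha,\beta)$ and $\phi\in\mathcal{K}$. Then $f\ast(\phi+\lambda\overline{\phi})\in\mathcal{B}_{\mathcal{H}}^0(\alpha,\beta)$ for every $\lambda\in\mathbb{C}$ with $|\lambda|=1$.
   Context: $\mathbb{D}=\{z\in\mathbb{C}:|z|<1\}$. $\mathcal{H}^0$ is the class of harmonic mappings $f=h+\overline{g}$ in $\mathbb{D}$, where $h,g$ are analytic in $\mathbb{D}$ with $h(0)=g(0)=0$, $h'(0)=1$ and $g'(0)=0$. For $\alpha>-1$ and $\beta>0$, $\mathcal{B}_{\mathcal{H}}^0(\alpha,\beta)$ is the set of $f=h+\overline{g}\in\mathcal{H}^0$ such that $|zh''(z)+\alpha(h'(z)-1)|\le \beta-|zg''(z)+\alpha g'(z)|$ for all $z\in\mathbb{D}$. $\mathcal{K}$ is the class of convex functions: analytic univalent functions $\phi$ in $\mathbb{D}$ with $\phi(0)=0$, $\phi'(0)=1$ and $\phi(\mathbb{D})$ convex. For analytic $\psi_1(z)=\sum_{n\ge0}a_nz^n$ and $\psi_2(z)=\sum_{n\ge0}b_nz^n$ in $\mathbb{D}$, the convolution is $(\psi_1\ast\psi_2)(z)=\sum_{n\ge0}a_nb_nz^n$; for harmonic mappings $f_1=h_1+\overline{g_1}$, $f_2=h_2+\overline{g_2}$ (with $h_j,g_j$ analytic in $\mathbb{D}$ and vanishing at $0$), $f_1\ast f_2=h_1\ast h_2+\overline{g_1\ast g_2}$. Here $\phi+\lambda\overline{\phi}$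 has analytic part $\phi$ and co-analytic part $\overline{\overline{\lambda}\phi}$, so for $f=h+\overline{g}$ one has $f\ast(\phi+\lambda\overline{\phi})=h\ast\phi+\overline{\overline{\lambda}(g\ast\phi)}$. *)

theory Defs
  imports "HOL-Complex_Analysis.Complex_Analysis"
begin

abbreviation unit_disc :: "complex set" where
  "unit_disc \<equiv> ball 0 1"

definition harmonic_parts :: "(complex \<Rightarrow> complex) \<Rightarrow> (complex \<Rightarrow> complex) \<Rightarrow> (complex \<Rightarrow> complex) \<Rightarrow> bool"
  where "harmonic_parts f h g \<longleftrightarrow>
    h holomorphic_on unit_disc \<and> g holomorphic_on unit_disc \<and> h 0 = 0 \<and> g 0 = 0 \<and>
    (\<forall>z\<in>unit_disc. f z = h z + cnj (g z))"

lemma holomorphic_real_valued_eq_0: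
  assumes "f holomorphic_on unit_disc" "f 0 = 0" "\<And>z. z \<in> unit_disc \<Longrightarrow> f z \<in> \<real>" "z \<in> unit_disc"
  shows "f z = 0"
proof (cases "f constant_on unit_disc")
  case True
  then show ?thesis
    using assms(2,4) unfolding constant_on_def by force
next
  case False
  then have "open (f ` unit_disc)"
    by (intro open_mapping_thm[OF assms(1)]) auto
  moreover have "0 \<in> f ` unit_disc"
    using assms(2) by (force simp: image_iff intro!: bexI[of _ 0])
  ultimately obtain e where e: "e > 0" "ball 0 e \<subseteq> f ` unit_disc"
    by (meson open_contains_ball)
  have "of_real (e/2) * \<i> \<in> ball 0 e"
    using e(1) by (simp add: norm_mult)
  then have "of_real (e/2) * \<i> \<in> \<real>"
    using e(2) assms(3) by (metis (no_types, lifting) imageE subsetD)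
  then show ?thesis
    using e(1) by (simp add: complex_is_Real_iff)
qed

lemma harmonic_parts_unique:
  assumes "harmonic_parts f h1 g1" "harmonic_parts f h2 g2" "z \<in> unit_disc"
  shows "h1 z = h2 z" "g1 z = g2 z"
proof -
  define d where "d = (\<lambda>z. h1 z - h2 z)"
  define e where "e = (\<lambda>z. g2 z - g1 z)"
  have hol: "d holomorphic_on unit_disc" "e holomorphic_on unit_disc"
    using assms(1,2) unfolding d_def e_def harmonic_parts_def by (auto intro!: holomorphic_intros)
  have z0: "d 0 = 0" "e 0 = 0"
    using assms(1,2) by (auto simp: d_def e_def harmonic_parts_def)
  have de: "d w = cnj (e w)" if "w \<in> unit_disc" for w
  proof -
    have "f w = h1 w + cnj (g1 w)" "f w = h2 w + cnj (g2 w)"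
      using assms(1,2) that unfolding harmonic_parts_def by blast+
    then have "h1 w = h2 w + cnj (g2 w) - cnj (g1 w)"
      by (simp add: eq_diff_eq)
    then show ?thesis by (simp add: d_def e_def)
  qed
  have "d z + e z = 0"
  proof (rule holomorphic_real_valued_eq_0[where f = "\<lambda>z. d z + e z", OF _ _ _ assms(3)])
    show "(\<lambda>z. d z + e z) holomorphic_on unit_disc"
      by (intro holomorphic_intros hol)
    show "d 0 + e 0 = 0" using z0 by simp
    show "d w + e w \<in> \<real>" if "w \<in> unit_disc" for w
      using de[OF that] by (simp add: complex_is_Real_iff)
  qed
  moreover have "\<i> * (d z - e z) = 0"
  proof (rule holomorphic_real_valued_eq_0[where f = "\<lambda>z. \<i> * (d z - e z)", OF _ _ _ assms(3)])
    show "(\<lambda>z. \<i> * (d z - e z)) holomorphic_on unit_disc"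
      by (intro holomorphic_intros hol)
    show "\<i> * (d 0 - e 0) = 0" using z0 by simp
    show "\<i> * (d w - e w) \<in> \<real>" if "w \<in> unit_disc" for w
      using de[OF that] by (simp add: complex_is_Real_iff)
  qed
  ultimately have "d z = 0" "e z = 0" by simp_all
  then show "h1 z = h2 z" "g1 z = g2 z" by (simp_all add: d_def e_def)
qed

text \<open>By the preceding lemma the values of the two parts on the disc do not depend on the
  choices made here; the values outside the disc are never used.\<close>

definition analytic_part :: "(complex \<Rightarrow> complex) \<Rightarrow> complex \<Rightarrow> complex" where
  "analytic_part f = (SOME h. \<exists>g. harmonic_parts f h g)"

definition coanalytic_part :: "(complex \<Rightarrow> complex) \<Rightarrow> complex \<Rightarrow> complex" where
  "coanalytic_part f = (SOME g. \<exists>h. harmonic_parts f h g)"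

definition harmonic_class_H0 :: "(complex \<Rightarrow> complex) set" where
  "harmonic_class_H0 =
    {f. \<exists>h g. harmonic_parts f h g \<and> deriv h 0 = 1 \<and> deriv g 0 = 0}"

definition harmonic_class_B0 :: "real \<Rightarrow> real \<Rightarrow> (complex \<Rightarrow> complex) set" where
  "harmonic_class_B0 \<alpha> \<beta> =
    {f \<in> harmonic_class_H0. \<exists>h g. harmonic_parts f h g \<and>
      (\<forall>z\<in>unit_disc.
        cmod (z * deriv (deriv h) z + of_real \<alpha> * (deriv h z - 1))
          \<le> \<beta> - cmod (z * deriv (deriv g) z + of_real \<alpha> * deriv g z))}"

definition convex_class_K :: "(complex \<Rightarrow> complex) set" where
  "convex_class_K =
    {\<phi>. \<phi> holomorphic_on unit_disc \<and> inj_on \<phi> unit_disc \<and> \<phi> 0 = 0 \<and> deriv \<phi> 0 = 1 \<and>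
      convex (\<phi> ` unit_disc)}"

definition analytic_conv :: "(complex \<Rightarrow> complex) \<Rightarrow> (complex \<Rightarrow> complex) \<Rightarrow> complex \<Rightarrow> complex" where
  "analytic_conv \<psi>1 \<psi>2 z =
    (\<Sum>n. fps_nth (fps_expansion \<psi>1 0) n * fps_nth (fps_expansion \<psi>2 0) n * z ^ n)"

definition harmonic_conv :: "(complex \<Rightarrow> complex) \<Rightarrow> (complex \<Rightarrow> complex) \<Rightarrow> complex \<Rightarrow> complex" where
  "harmonic_conv f1 f2 z =
    analytic_conv (analytic_part f1) (analytic_part f2) z +
    cnj (analytic_conv (coanalytic_part f1) (coanalytic_part f2) z)"

end

theory Submission
  imports Defs
begin

text \<open>
  Writing \<open>T h z = z h''(z) + \<alpha> h'(z)\<close>, convolution with \<open>\<phi>\<close> acts on \<open>T h\<close> as the Hadamard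
  product with \<open>\<phi>(z)/z\<close>. For convex \<open>\<phi>\<close> one has \<open>Re (\<phi>(z)/z) \<ge> 1/2\<close>, so
  \<open>2 Re (\<phi>(z)/z) - 1\<close> is a nonnegative kernel of mean value 1 on circles, and the Hadamard product
  with \<open>\<phi>(z)/z\<close> is an average that preserves sup-norm bounds. This is applied to
  \<open>T h - \<alpha> + \<epsilon> T g\<close> for all unimodular \<open>\<epsilon>\<close>.

  The bound \<open>Re (\<phi>(z)/z) \<ge> 1/2\<close> is equivalent to \<open>\<bar>z/\<phi>(z) - 1\<bar> \<le> 1\<close>. For \<open>\<bar>z\<bar> = \<bar>a\<bar>\<close> the Schwarz
  lemma, applied to \<open>\<phi>\<^sup>-\<^sup>1((1 - s) \<phi>(u) + s \<phi>(xu))\<close> with \<open>xz = a\<close>, shows that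
  \<open>H(z) = 2z\<phi>'(z)/(\<phi>(z) - \<phi>(a)) - (z + a)/(z - a)\<close> has nonnegative real part; by the maximum
  principle this extends to \<open>\<bar>z\<bar> \<le> \<bar>a\<bar>\<close>, and the coefficient estimate for \<open>H'(0) = 2/a - 2/\<phi>(a)\<close>
  gives the claim at \<open>a\<close>.
\<close>

section \<open>Fourier integrals and Hadamard multiplication by a positive kernel\<close>

lemma integral_sums_M_test:
  fixes f :: "nat \<Rightarrow> real \<Rightarrow> 'a::banach"
  assumes cont: "\<And>n. continuous_on {a..b} (f n)"
    and le: "\<And>n t. t \<in> {a..b} \<Longrightarrow> norm (f n t) \<le> M n" and M: "summable M"
  shows "(\<lambda>n. integral {a..b} (f n)) sums integral {a..b} (\<lambda>t. \<Sum>n. f n t)"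
proof -
  have ul: "uniform_limit {a..b} (\<lambda>n t. \<Sum>i<n. f i t) (\<lambda>t. \<Sum>n. f n t) sequentially"
    using le M by (rule Weierstrass_m_test)
  obtain I J where IJ: "\<And>n. ((\<lambda>t. \<Sum>i<n. f i t) has_integral I n) {a..b}"
      "((\<lambda>t. \<Sum>n. f n t) has_integral J) {a..b}" "I \<longlonglongrightarrow> J"
    using uniform_limit_integral[OF ul] cont by (auto intro!: continuous_on_sum)
  have "I n = (\<Sum>i<n. integral {a..b} (f i))" for n
    using integral_unique[OF IJ(1)[of n]]
    by (simp add: integral_sum integrable_continuous_real[OF cont])
  then have "I = (\<lambda>n. \<Sum>i<n. integral {a..b} (f i))" ..
  with IJ(3) integral_unique[OF IJ(2)] show ?thesis
    unfolding sums_def by simp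
qed

lemma integral_cis_multiple:
  "integral {0..2 * pi} (\<lambda>t. cis (of_int k * t)) = (if k = 0 then 2 * pi else 0)"
proof (cases "k = 0")
  case False
  have "((\<lambda>t. cis (of_int k * t)) has_integral
      (cis (of_int k * (2 * pi)) / (\<i> * of_int k) - cis (of_int k * 0) / (\<i> * of_int k))) {0..2 * pi}"
  proof (rule fundamental_theorem_of_calculus)
    fix x :: real
    have "((\<lambda>w. exp (\<i> * (of_int k * w)) / (\<i> * of_int k)) has_field_derivative
        exp (\<i> * (of_int k * of_real x))) (at (of_real x))"
      using False by (auto intro!: derivative_eq_intros simp: mult.commute[of _ \<i>])
    from has_vector_derivative_real_field[OF this]
    show "((\<lambda>t. cis (of_int k * t) / (\<i> * of_int k)) has_vector_derivative
        cis (of_int k * x)) (at x within {0..2 * pi})"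
      by (simp add: cis_conv_exp has_vector_derivative_at_within)
  qed simp
  moreover have "cis (of_int k * (2 * pi)) = 1"
    using cis_multiple_2pi[of "of_int k"] by (simp add: mult_ac)
  ultimately show ?thesis
    using False by (simp add: integral_unique)
qed (simp add: scaleR_conv_of_real)

text \<open>The frequencies \<open>k n\<close> are arbitrary integers so that both the kernel series
  (frequencies \<open>n\<close>) and the averaged series (frequencies \<open>- n\<close>) are
  covered.\<close>

lemma continuous_on_suminf_cis:
  fixes a :: "nat \<Rightarrow> complex"
  assumes "summable (\<lambda>n. norm (a n))"
  shows "continuous_on S (\<lambda>t. \<Sum>n. a n * cis (of_int (k n) * t))"
proof (rule uniform_limit_theorem)
  show "uniform_limit S (\<lambda>n t. \<Sum>i<n. a i * cis (of_int (k i) * t))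
      (\<lambda>t. \<Sum>n. a n * cis (of_int (k n) * t)) sequentially"
    by (rule Weierstrass_m_test[OF _ assms]) (simp add: norm_mult)
qed (auto intro!: always_eventually continuous_intros)

text \<open>The series has only nonnegative frequencies, so by orthogonality the factor of frequency
  \<open>k\<close> picks out the coefficient at \<open>- k\<close>, and nothing survives when
  \<open>k\<close> is positive.\<close>

lemma integral_cis_mult_suminf:
  fixes a :: "nat \<Rightarrow> complex"
  assumes a: "summable (\<lambda>n. norm (a n))"
  shows "integral {0..2 * pi} (\<lambda>t. cis (of_int k * t) * (\<Sum>n. a n * cis (of_int (int n) * t))) =
    (if k \<le> 0 then 2 * pi * a (nat (- k)) else 0)"
proof -
  have s: "summable (\<lambda>n. a n * cis (of_int (int n) * t))" for t
    by (rule summable_norm_cancel) (simp add: norm_mult a)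
  have eq: "cis (of_int k * t) * (\<Sum>n. a n * cis (of_int (int n) * t)) =
      (\<Sum>n. a n * cis (of_int (k + int n) * t))" for t
    by (subst suminf_mult[OF s, symmetric])
       (simp add: cis_mult[symmetric] ring_distribs mult_ac)
  have "(\<lambda>n. integral {0..2 * pi} (\<lambda>t. a n * cis (of_int (k + int n) * t))) sums
      integral {0..2 * pi} (\<lambda>t. \<Sum>n. a n * cis (of_int (k + int n) * t))"
    by (rule integral_sums_M_test[OF _ _ a]) (auto intro!: continuous_intros simp: norm_mult)
  moreover have "integral {0..2 * pi} (\<lambda>t. a n * cis (of_int (k + int n) * t)) =
      (if n = nat (- k) then (if k \<le> 0 then 2 * pi * a n else 0) else 0)" for n
    by (subst integral_mult_right, subst integral_cis_multiple) auto
  ultimately have "(\<lambda>n. if n = nat (- k) then (if k \<le> 0 then 2 * pi * a n else 0) else 0) sums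
      integral {0..2 * pi} (\<lambda>t. \<Sum>n. a n * cis (of_int (k + int n) * t))"
    by simp
  from sums_unique2[OF this sums_single] show ?thesis
    unfolding eq by auto
qed

lemma hadamard_product_bound:
  fixes c p :: "nat \<Rightarrow> complex"
  assumes P: "\<And>z. norm z < 1 \<Longrightarrow> (\<lambda>n. c n * z ^ n) sums P z"
    and PB: "\<And>z. norm z < 1 \<Longrightarrow> norm (P z) \<le> B"
    and q: "\<And>z. norm z < 1 \<Longrightarrow> (\<lambda>n. p n * z ^ n) sums q z"
    and p0: "p 0 = 1" and Re_q: "\<And>z. norm z < 1 \<Longrightarrow> Re (q z) \<ge> 1 / 2"
    and z: "norm z < 1"
  shows "norm (\<Sum>n. c n * p n * z ^ n) \<le> B"
proof -
  \<comment> \<open>Any radius strictly between \<open>norm z\<close> and 1 works: then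
    \<open>r\<close> and \<open>norm z / r\<close> are both below 1, so the series of
    \<open>q\<close> and of \<open>P\<close> converge absolutely there.\<close>
  define r where "r = (norm z + 1) / 2"
  have r: "0 < r" "r < 1" "norm z < r"
    using z norm_ge_zero[of z] by (auto simp: r_def simp del: norm_ge_zero)
  have abs: "summable (\<lambda>n. norm (s n * w ^ n))"
    if "\<And>z. norm z < 1 \<Longrightarrow> (\<lambda>n. s n * z ^ n) sums F z" "norm w < 1"
    for s :: "nat \<Rightarrow> complex" and F w
  proof -
    define R where "R = (norm w + 1) / 2"
    have "norm w < R" "norm R < 1"
      using that(2) by (auto simp: R_def)
    then show ?thesis
      using that(1)[of "of_real R"] powser_insidea[of s "of_real R" w] by (auto simp: sums_iff)
  qed
  \<comment> \<open>The sum equals the mean over \<open>t\<close> of \<open>E t * K t\<close>, where \<open>E t = P ((z/r) e\<^sup>-\<^sup>i\<^sup>t)\<close> and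
    \<open>K t = 2 Re (q (r e\<^sup>i\<^sup>t)) - 1 \<ge> 0\<close> has mean 1.\<close>
  define a where "a n = p n * of_real r ^ n" for n
  define b where "b n = c n * (z / of_real r) ^ n" for n
  have a: "summable (\<lambda>n. norm (a n))"
    unfolding a_def using r by (intro abs[OF q]) auto
  have b: "summable (\<lambda>n. norm (b n))"
    unfolding b_def using r by (intro abs[OF P]) (auto simp: norm_divide)
  define Q where "Q t = (\<Sum>n. a n * cis (of_int (int n) * t))" for t
  define E where "E t = (\<Sum>n. b n * cis (of_int (- int n) * t))" for t
  have Q: "Q t = q (of_real r * cis t)" for t
    using sums_unique[OF q[of "of_real r * cis t"]] r
    by (simp add: Q_def a_def norm_mult power_mult_distrib Complex.DeMoivre mult_ac)
  have E: "E t = P (z / of_real r * cis (- t))" for t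
    using sums_unique[OF P[of "z / of_real r * cis (- t)"]] r
    unfolding E_def b_def
    by (simp add: norm_mult norm_divide power_mult_distrib power_divide Complex.DeMoivre mult_ac)
  have contQ: "continuous_on S Q" for S
    unfolding Q_def by (rule continuous_on_suminf_cis[OF a])
  have contE: "continuous_on S E" for S
    unfolding E_def by (rule continuous_on_suminf_cis[OF b])
  define K where "K t = 2 * Re (Q t) - 1" for t
  have contK: "continuous_on S K" for S
    unfolding K_def by (intro continuous_intros contQ)
  have Kpos: "K t \<ge> 0" for t
    using Re_q[of "of_real r * cis t"] r by (simp add: K_def Q norm_mult)
  have K_eq: "of_real (K t) = Q t + cnj (Q t) - 1" for t
    by (simp add: K_def complex_eq_iff)
  \<comment> \<open>In \<open>K = Q + cnj Q - 1\<close> only \<open>Q\<close> contributes when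
    \<open>n > 0\<close>. At \<open>n = 0\<close> all three terms do, and \<open>p 0 = 1\<close>
    makes their total \<open>1 + 1 - 1 = a 0\<close>.\<close>
  have K_coeff: "integral {0..2 * pi} (\<lambda>t. cis (of_int (- int n) * t) * of_real (K t)) =
      2 * pi * a n" for n
  proof -
    have "integral {0..2 * pi} (\<lambda>t. cis (of_int (- int n) * t) * of_real (K t)) =
      integral {0..2 * pi} (\<lambda>t. cis (of_int (- int n) * t) * Q t +
        cnj (cis (of_int (int n) * t) * Q t) - cis (of_int (- int n) * t))"
      by (rule integral_cong) (simp add: K_eq cis_cnj algebra_simps)
    also have "\<dots> = integral {0..2 * pi} (\<lambda>t. cis (of_int (- int n) * t) * Q t) +
        integral {0..2 * pi} (\<lambda>t. cnj (cis (of_int (int n) * t) * Q t)) -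
        integral {0..2 * pi} (\<lambda>t. cis (of_int (- int n) * t))"
      by (subst integral_diff integral_add;
          (intro integrable_continuous_real continuous_intros contQ)?)+ simp
    also have "\<dots> = 2 * pi * a n"
      unfolding integral_cnj[symmetric] Q_def
      by (subst integral_cis_mult_suminf[OF a] integral_cis_multiple)+ (auto simp: a_def p0)
    finally show ?thesis .
  qed
  have "integral {0..2 * pi} (\<lambda>t. complex_of_real (K t)) = of_real (integral {0..2 * pi} K)"
    by (intro integral_unique has_integral_of_real integrable_integral integrable_continuous_real contK)
  then have K_int: "integral {0..2 * pi} K = 2 * pi"
    using K_coeff[of 0] by (simp add: a_def p0 flip: of_real_eq_iff[where 'a = complex])
  have "(\<lambda>n. integral {0..2 * pi} (\<lambda>t. b n * (cis (of_int (- int n) * t) * of_real (K t)))) sums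
      integral {0..2 * pi} (\<lambda>t. \<Sum>n. b n * (cis (of_int (- int n) * t) * of_real (K t)))"
  proof -
    obtain C where C: "\<And>t. t \<in> {0..2 * pi} \<Longrightarrow> norm (K t) \<le> C"
      using compact_imp_bounded[OF compact_continuous_image[OF contK compact_Icc]]
      unfolding bounded_iff by blast
    show ?thesis
    proof (rule integral_sums_M_test)
      show "norm (b n * (cis (of_int (- int n) * t) * of_real (K t))) \<le> norm (b n) * C"
        if "t \<in> {0..2 * pi}" for n t
        using C[OF that] by (simp add: norm_mult mult_left_mono)
    qed (auto intro!: continuous_intros contK summable_mult2 b)
  qed
  also have "(\<lambda>t. \<Sum>n. b n * (cis (of_int (- int n) * t) * of_real (K t))) = (\<lambda>t. E t * of_real (K t))"
  proof
    fix t
    have "summable (\<lambda>n. b n * cis (of_int (- int n) * t))"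
      by (rule summable_norm_cancel) (simp add: norm_mult b)
    then show "(\<Sum>n. b n * (cis (of_int (- int n) * t) * of_real (K t))) = E t * of_real (K t)"
      unfolding E_def by (subst suminf_mult2) (simp_all add: mult_ac)
  qed
  also have "(\<lambda>n. integral {0..2 * pi} (\<lambda>t. b n * (cis (of_int (- int n) * t) * of_real (K t)))) =
      (\<lambda>n. 2 * pi * (c n * p n * z ^ n))"
    using r by (subst integral_mult_right, subst K_coeff) (simp add: a_def b_def power_divide mult_ac)
  finally have "(\<lambda>n. c n * p n * z ^ n) sums (integral {0..2 * pi} (\<lambda>t. E t * of_real (K t)) / (2 * pi))"
    using sums_divide[of _ _ "of_real (2 * pi)"] by fastforce
  then have "norm (\<Sum>n. c n * p n * z ^ n) =
      norm (integral {0..2 * pi} (\<lambda>t. E t * of_real (K t))) / (2 * pi)"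
    by (simp add: sums_iff norm_divide)
  also have "norm (integral {0..2 * pi} (\<lambda>t. E t * of_real (K t))) \<le> integral {0..2 * pi} (\<lambda>t. B * K t)"
  proof (rule integral_norm_bound_integral)
    show "norm (E t * of_real (K t)) \<le> B * K t" for t
      using PB[of "z / of_real r * cis (- t)"] r Kpos[of t]
      by (simp add: E norm_mult norm_divide mult_right_mono)
  qed (auto intro!: integrable_continuous_real continuous_intros contE contK)
  also have "integral {0..2 * pi} (\<lambda>t. B * K t) = B * (2 * pi)"
    by (simp add: K_int)
  finally show ?thesis
    by (simp add: divide_right_mono)
qed

section \<open>The half-plane bound for convex functions\<close>

text \<open>The segment from \<open>\<phi> z\<close> to \<open>\<phi> w\<close> pulls back to a
  curve that starts at \<open>z\<close> and never leaves the closed disc of radius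
  \<open>norm z\<close>. Its initial velocity therefore has nonpositive inner product with
  \<open>z\<close>.\<close>

lemma convex_image_Re_difference_quotient_nonneg:
  assumes hol: "\<phi> holomorphic_on ball 0 1" and inj: "inj_on \<phi> (ball 0 1)"
    and conv: "convex (\<phi> ` ball 0 1)"
    and wz: "norm w \<le> norm z" and z1: "norm z < 1" and z0: "z \<noteq> 0"
  shows "Re ((\<phi> z - \<phi> w) / (z * deriv \<phi> z)) \<ge> 0"
proof -
  obtain g where g: "g holomorphic_on (\<phi> ` ball 0 1)"
      "\<And>u. u \<in> ball 0 1 \<Longrightarrow> deriv \<phi> u * deriv g (\<phi> u) = 1"
      "\<And>u. u \<in> ball 0 1 \<Longrightarrow> g (\<phi> u) = u"
    using holomorphic_has_inverse[OF hol open_ball inj] by blast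
  have op: "open (\<phi> ` ball 0 1)"
    by (rule open_mapping_thm3[OF hol open_ball inj])
  \<comment> \<open>Writing \<open>w = x * z\<close> embeds the pair \<open>(z, w)\<close> in the
    family \<open>(u, x * u)\<close>. The pulled-back convex combination is then a holomorphic
    self-map of the disc fixing 0, and the Schwarz lemma applies to it at
    \<open>u = z\<close>.\<close>
  define x where "x = w / z"
  have x: "norm x \<le> 1"
    using wz z0 by (simp add: x_def norm_divide)
  have xu: "x * u \<in> ball 0 1" if "u \<in> ball 0 1" for u
    using that x mult_left_le_one_le[of "norm u" "norm x"] by (auto simp: norm_mult)
  define d where "d = \<phi> w - \<phi> z"
  define v where "v s = g (\<phi> z + of_real s * d)" for s :: real
  have v_le: "norm (v s) \<le> norm (v 0)" if s: "0 \<le> s" "s \<le> 1" for s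
  proof -
    define W where "W u = g (\<phi> u + of_real s * (\<phi> (x * u) - \<phi> u))" for u
    have mem: "\<phi> u + of_real s * (\<phi> (x * u) - \<phi> u) \<in> \<phi> ` ball 0 1" if "u \<in> ball 0 1" for u
    proof -
      have "(1 - s) *\<^sub>R \<phi> u + s *\<^sub>R \<phi> (x * u) \<in> \<phi> ` ball 0 1"
        using conv s that xu[OF that] by (intro convexD) auto
      then show ?thesis
        by (simp add: scaleR_conv_of_real algebra_simps)
    qed
    have "W holomorphic_on ball 0 1"
    proof -
      have "(\<lambda>u. \<phi> (x * u)) holomorphic_on ball 0 1"
        using holomorphic_on_compose_gen[of "\<lambda>u. x * u" "ball 0 1" \<phi> "ball 0 1"] hol xu
        by (auto simp: o_def image_subset_iff intro!: holomorphic_intros)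
      then have "(\<lambda>u. \<phi> u + of_real s * (\<phi> (x * u) - \<phi> u)) holomorphic_on ball 0 1"
        by (intro holomorphic_intros hol)
      from holomorphic_on_compose_gen[OF this g(1)] mem show ?thesis
        unfolding W_def o_def by blast
    qed
    moreover have "W 0 = 0"
      using g(3)[of 0] by (simp add: W_def)
    moreover have "norm (W u) < 1" if "norm u < 1" for u
      using mem[of u] g(3) that by (force simp: W_def)
    ultimately have "norm (W z) \<le> norm z"
      using z1 by (rule Schwarz_Lemma)
    moreover have "W z = v s" "v 0 = z"
      using z0 z1 g(3)[of z] by (simp_all add: W_def v_def x_def d_def)
    ultimately show ?thesis by simp
  qed
  have v0: "v 0 = z"
    using g(3)[of z] z1 by (simp add: v_def)
  \<comment> \<open>\<open>D\<close> is the velocity of \<open>v\<close> at 0. The quotient in the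
    claim equals \<open>- D / z\<close>, whose real part is minus the inner product of
    \<open>z\<close> and \<open>D\<close>, divided by the square of \<open>norm z\<close>.\<close>
  define D where "D = d * deriv g (\<phi> z)"
  have "(g has_field_derivative deriv g (\<phi> z)) (at (\<phi> z))"
    using holomorphic_derivI[OF g(1) op] z1 by simp
  then have "(g \<circ> (\<lambda>s. \<phi> z + of_real s * d) has_vector_derivative D) (at 0)"
    unfolding D_def by (intro field_vector_diff_chain_at) (auto intro!: derivative_eq_intros)
  then have v': "(v has_derivative (\<lambda>h. h *\<^sub>R D)) (at 0)"
    by (simp add: has_vector_derivative_def o_def v_def[abs_def])
  have der: "((\<lambda>s. v s \<bullet> v s) has_real_derivative 2 * (z \<bullet> D)) (at 0)"
    using has_derivative_inner[OF v' v']
    by (simp add: has_field_derivative_def v0 inner_commute algebra_simps mult_commute_abs)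
  \<comment> \<open>\<open>\<bar>v s\<bar>\<close> is maximal at the left end point \<open>s = 0\<close>.\<close>
  have "z \<bullet> D \<le> 0"
  proof (rule ccontr)
    assume "\<not> z \<bullet> D \<le> 0"
    then obtain e where e: "e > 0" "\<And>h. 0 < h \<Longrightarrow> h < e \<Longrightarrow> v 0 \<bullet> v 0 < v (0 + h) \<bullet> v (0 + h)"
      using DERIV_pos_inc_right[OF der] by auto
    define h where "h = min (e / 2) 1"
    have h: "0 < h" "h < e" "h \<le> 1"
      using e(1) by (auto simp: h_def min_def)
    have "v h \<bullet> v h \<le> v 0 \<bullet> v 0"
      using v_le[of h] h by (simp add: dot_square_norm power_mono)
    with e(2)[OF h(1,2)] show False by simp
  qed
  moreover have "(\<phi> z - \<phi> w) / (z * deriv \<phi> z) = - D / z"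
  proof -
    have "deriv g (\<phi> z) = 1 / deriv \<phi> z"
      using g(2)[of z] z1 by (simp add: eq_divide_eq mult.commute) auto
    then show ?thesis
      by (simp add: D_def d_def mult.commute) (metis minus_diff_eq minus_divide_left)
  qed
  ultimately show ?thesis
    by (simp add: Re_divide inner_complex_def divide_nonpos_nonneg mult.commute)
qed

lemma Re_inverse_nonneg: "Re u \<ge> 0 \<Longrightarrow> Re (1 / u) \<ge> 0"
  by (simp add: Re_divide)

text \<open>The Caratheodory coefficient bound for functions of nonnegative real part, used on the
  disc of radius \<open>norm a\<close>, gives |H'(0)| <= 2/|a|. Multiplying by |a|/2 yields the
  claim.\<close>

lemma convex_norm_ratio_minus_1_le:
  assumes hol: "\<phi> holomorphic_on ball 0 1" and inj: "inj_on \<phi> (ball 0 1)"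
    and conv: "convex (\<phi> ` ball 0 1)" and \<phi>0: "\<phi> 0 = 0" "deriv \<phi> 0 = 1"
    and a0: "a \<noteq> 0" and a1: "norm a < 1"
  shows "norm (a / \<phi> a - 1) \<le> 1"
proof -
  define r where "r = norm a"
  have r: "0 < r" "r < 1"
    using a0 a1 by (auto simp: r_def)
  have \<phi>_eq: "\<phi> z = \<phi> w \<longleftrightarrow> z = w" if "norm z < 1" "norm w < 1" for z w
    using inj that by (auto simp: inj_on_def)
  have \<phi>': "deriv \<phi> z \<noteq> 0" if "norm z < 1" for z
    using holomorphic_injective_imp_regular[OF hol open_ball inj] that by simp
  have hol': "deriv \<phi> holomorphic_on ball 0 1"
    using hol by (intro holomorphic_deriv) auto
  \<comment> \<open>The difference quotient, completed at \<open>a\<close>, is zero-free on the disc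
    by injectivity and the nonvanishing of \<open>deriv \<phi>\<close>, so it may serve as a
    denominator.\<close>
  define E where "E z = (if z = a then deriv \<phi> a else (\<phi> z - \<phi> a) / (z - a))" for z
  have holE: "E holomorphic_on ball 0 1"
    unfolding E_def by (rule pole_lemma_open[OF hol open_ball])
  have E0: "E z \<noteq> 0" if "norm z < 1" for z
    using that \<phi>'[OF a1] \<phi>_eq[of z a] a1 by (auto simp: E_def)
  \<comment> \<open>Over the common denominator \<open>(z - a) * E z\<close> the numerator of
    \<open>H\<close> is \<open>N\<close>. Since \<open>N a = 0\<close>, the singularity of
    \<open>H\<close> at \<open>a\<close> is removable.\<close>
  define N where "N z = 2 * z * deriv \<phi> z - (z + a) * E z" for z
  have holN: "N holomorphic_on ball 0 1"
    unfolding N_def by (intro holomorphic_intros holE hol')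
  have Na: "N a = 0"
    by (simp add: N_def E_def)
  define H where "H z = (if z = a then deriv N a else (N z - N a) / (z - a)) / E z" for z
  have holH: "H holomorphic_on ball 0 1"
    unfolding H_def using E0 by (intro holomorphic_intros pole_lemma_open[OF holN open_ball] holE) auto
  have H_eq: "H z = 2 * (z * deriv \<phi> z / (\<phi> z - \<phi> a)) - (z + a) / (z - a)"
    if "norm z < 1" "z \<noteq> a" for z
  proof -
    have "(2 * z * p - (z + a) * (F / y)) / y / (F / y) = 2 * (z * p / F) - (z + a) / y"
      if "F \<noteq> 0" "y \<noteq> 0" for F y p :: complex
      using that by (simp add: field_simps)
    from this[of "\<phi> z - \<phi> a" "z - a" "deriv \<phi> z"] show ?thesis
      using that \<phi>_eq[of z a] a1 by (simp add: H_def Na N_def E_def)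
  qed
  have H0: "H 0 = 1"
    using H_eq[of 0] a0 by simp
  \<comment> \<open>The subtracted term \<open>(z + a) / (z - a)\<close> is purely imaginary on the
    circle through \<open>a\<close>: it cancels the pole without changing the real part
    there.\<close>
  have H_sphere': "Re (H z) \<ge> 0" if z: "norm z = r" "z \<noteq> a" for z
  proof -
    have "Re ((\<phi> z - \<phi> a) / (z * deriv \<phi> z)) \<ge> 0"
      using z r by (intro convex_image_Re_difference_quotient_nonneg hol inj conv) (auto simp: r_def)
    from Re_inverse_nonneg[OF this] have "Re (z * deriv \<phi> z / (\<phi> z - \<phi> a)) \<ge> 0"
      by simp
    moreover have "Re ((z + a) / (z - a)) = 0"
    proof -
      have "(Re z)\<^sup>2 + (Im z)\<^sup>2 = (Re a)\<^sup>2 + (Im a)\<^sup>2"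
        using z(1) by (simp add: r_def flip: cmod_power2)
      then show ?thesis
        by (simp add: Re_divide power2_eq_square algebra_simps)
    qed
    moreover have "Re (2 * X - Y) \<ge> 0" if "Re X \<ge> 0" "Re Y = 0" for X Y
      using that by simp
    moreover have "norm z < 1"
      using z r by simp
    ultimately show ?thesis
      using H_eq[OF _ z(2)] by metis
  qed
  have H_sphere: "Re (H z) \<ge> 0" if z: "norm z = r" for z
  proof (cases "z = a")
    case True
    \<comment> \<open>The point \<open>a\<close> itself is reached by continuity along the circle.
      The angles lie in (0, 1], where the sine is positive, so \<open>s n\<close> differs from
      \<open>a\<close>.\<close>
    define s where "s n = a * cis (inverse (real (Suc n)))" for n
    have "s \<longlonglongrightarrow> a * cis 0"
      unfolding s_def
      by (intro tendsto_intros LIMSEQ_inverse_real_of_nat)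
    then have "s \<longlonglongrightarrow> a" by simp
    moreover have "isCont H a"
      using holomorphic_on_imp_continuous_on[OF holH] a1
      by (simp add: continuous_on_eq_continuous_at)
    ultimately have "(\<lambda>n. Re (H (s n))) \<longlonglongrightarrow> Re (H a)"
      by (intro tendsto_Re isCont_tendsto_compose[of a H])
    moreover have "Re (H (s n)) \<ge> 0" for n
    proof (rule H_sphere')
      have "inverse (real (Suc n)) \<le> 1"
        by (simp add: field_simps)
      then have "sin (inverse (real (Suc n))) > 0"
        using pi_gt3 by (intro sin_gt_zero) auto
      then have "cis (inverse (real (Suc n))) \<noteq> 1"
        by (auto simp: complex_eq_iff)
      then show "s n \<noteq> a"
        using a0 by (simp add: s_def)
    qed (simp add: s_def norm_mult r_def)
    ultimately show ?thesis
      unfolding True by (intro LIMSEQ_le_const) auto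
  qed (use H_sphere' z in blast)
  have H_cball: "Re (H z) \<ge> 0" if "z \<in> cball 0 r" for z
  proof -
    have sub: "cball (0::complex) r \<subseteq> ball 0 1"
      using r by auto
    have "Re (- H z) \<le> 0"
    proof (rule maximum_real_frontier[where f = "\<lambda>z. - H z" and S = "cball 0 r"])
      show "(\<lambda>z. - H z) holomorphic_on interior (cball 0 r)"
        using sub interior_subset by (intro holomorphic_intros holomorphic_on_subset[OF holH]) blast
      show "continuous_on (closure (cball 0 r)) (\<lambda>z. - H z)"
        using sub by (intro continuous_intros holomorphic_on_imp_continuous_on holomorphic_on_subset[OF holH]) simp
    qed (use that H_sphere in auto)
    then show ?thesis by simp
  qed
  \<comment> \<open>The Cayley transform carries the right half-plane into the unit disc, so
    Cauchy's inequality on the circle of radius \<open>r\<close> bounds \<open>deriv w 0\<close>. As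
    \<open>H 0 = 1\<close>, this derivative is half that of \<open>H\<close>.\<close>
  define w where "w z = (H z - 1) / (H z + 1)" for z
  have H1: "H z + 1 \<noteq> 0" if "z \<in> cball 0 r" for z
    using H_cball[OF that] by (auto simp: complex_eq_iff)
  have holw: "w holomorphic_on cball 0 r"
    unfolding w_def using H1 r
    by (intro holomorphic_intros holomorphic_on_subset[OF holH]) auto
  have "norm ((deriv ^^ 1) w 0) \<le> fact 1 * 1 / r ^ 1"
  proof (rule Cauchy_inequality)
    show "norm (w z) \<le> 1" if "norm (0 - z) = r" for z
    proof -
      have "norm (H z - 1) \<le> norm (H z + 1)"
        using H_sphere[of z] that by (simp add: cmod_def power2_eq_square algebra_simps)
      then show ?thesis
        using H1[of z] that by (simp add: w_def norm_divide divide_le_eq_1)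
    qed
  qed (use r holw in \<open>auto intro: holomorphic_on_subset holomorphic_on_imp_continuous_on\<close>)
  moreover have "deriv w 0 = 1 / a - 1 / \<phi> a"
  proof (rule DERIV_imp_deriv)
    have "((\<lambda>z. 2 * (z * deriv \<phi> z / (\<phi> z - \<phi> a)) - (z + a) / (z - a)) has_field_derivative
        2 * (1 / a - 1 / \<phi> a)) (at 0)"
    proof -
      have d: "(\<phi> has_field_derivative deriv \<phi> 0) (at 0)"
          "(deriv \<phi> has_field_derivative deriv (deriv \<phi>) 0) (at 0)"
        using holomorphic_derivI[OF hol] holomorphic_derivI[OF hol'] by auto
      show ?thesis
        using a0 \<phi>_eq[of a 0] a1 \<phi>0
        by (auto intro!: derivative_eq_intros d simp: field_simps power2_eq_square)
    qed
    moreover have "\<forall>\<^sub>F z in nhds 0. H z = 2 * (z * deriv \<phi> z / (\<phi> z - \<phi> a)) - (z + a) / (z - a)"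
      using r by (intro eventually_nhds_in_open[THEN eventually_mono, of "ball 0 r"] H_eq) (auto simp: r_def)
    ultimately have "(H has_field_derivative 2 * (1 / a - 1 / \<phi> a)) (at 0)"
      by (subst DERIV_cong_ev) auto
    then show "(w has_field_derivative 1 / a - 1 / \<phi> a) (at 0)"
      unfolding w_def by (auto intro!: derivative_eq_intros simp: H0 field_simps)
  qed
  ultimately have "norm (1 / a - 1 / \<phi> a) \<le> 1 / r"
    by simp
  then have "norm a * norm (1 / a - 1 / \<phi> a) \<le> 1"
    using r by (simp add: r_def field_simps)
  moreover have "a / \<phi> a - 1 = - (a * (1 / a - 1 / \<phi> a))"
    using a0 by (simp add: field_simps)
  ultimately show ?thesis
    by (simp only: norm_minus_cancel norm_mult)
qed

text \<open>With \<open>u = z / \<phi> z\<close>, the bound |u - 1| <= 1 expands to |u|^2 <= 2 Re u,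
  which is Re (1/u) >= 1/2.\<close>

lemma convex_Re_div_ge_half:
  assumes "\<phi> holomorphic_on ball 0 1" "inj_on \<phi> (ball 0 1)"
    and "convex (\<phi> ` ball 0 1)" "\<phi> 0 = 0" "deriv \<phi> 0 = 1"
    and z: "z \<noteq> 0" "norm z < 1"
  shows "Re (\<phi> z / z) \<ge> 1 / 2"
proof -
  define u where "u = z / \<phi> z"
  have "\<phi> z \<noteq> 0"
    using assms by (metis centre_in_ball inj_on_eq_iff mem_ball_0 zero_less_one)
  then have u: "u \<noteq> 0" "\<phi> z / z = 1 / u"
    using z by (simp_all add: u_def)
  have "norm (u - 1) \<le> 1"
    unfolding u_def by (rule convex_norm_ratio_minus_1_le) fact+
  then have "(norm (u - 1))\<^sup>2 \<le> 1"
    by (simp add: power_le_one)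
  then have "(Re u)\<^sup>2 + (Im u)\<^sup>2 \<le> 2 * Re u"
    unfolding cmod_power2 by (simp add: power2_eq_square algebra_simps)
  moreover have "(Re u)\<^sup>2 + (Im u)\<^sup>2 > 0"
    using u(1) by (metis cmod_power2 norm_eq_zero zero_less_power2)
  ultimately show ?thesis
    by (simp add: u(2) Re_divide field_simps)
qed

section \<open>Power series on the disc, convolution and harmonic parts\<close>

text \<open>Split \<open>r\<close> as \<open>s * s\<close> with \<open>s < 1\<close>: the terms of
  \<open>G\<close> at \<open>s\<close> are bounded and those of \<open>F\<close> at \<open>s\<close>
  are absolutely summable.\<close>

lemma fps_conv_radius_hadamard:
  assumes "fps_conv_radius F \<ge> 1" "fps_conv_radius G \<ge> 1"
  shows "fps_conv_radius (Abs_fps (\<lambda>n. fps_nth F n * fps_nth G n :: complex)) \<ge> 1"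
  unfolding fps_conv_radius_def
proof (rule conv_radius_geI_ex')
  fix r :: real
  assume r: "0 < r" "ereal r < 1"
  define s where "s = sqrt r"
  have s: "0 < s" "s < 1" "r = s * s"
    using r by (auto simp: s_def)
  have "summable (\<lambda>n. norm (fps_nth H n * of_real s ^ n))" if "fps_conv_radius H \<ge> 1" for H :: "complex fps"
    using that s by (intro norm_summable_fps) (auto intro: less_le_trans[of _ 1])
  note sF = this[OF assms(1)] and sG = this[OF assms(2)]
  from summable_norm_cancel[OF sG] have "Bseq (\<lambda>n. fps_nth G n * of_real s ^ n)"
    by (intro convergent_imp_Bseq) (auto intro: convergentI dest: summable_LIMSEQ_zero)
  then obtain K where K: "\<And>n. norm (fps_nth G n * of_real s ^ n) \<le> K"
    by (auto simp: Bseq_def)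
  show "summable (\<lambda>n. fps_nth (Abs_fps (\<lambda>n. fps_nth F n * fps_nth G n)) n * of_real r ^ n)"
  proof (rule summable_comparison_test')
    show "summable (\<lambda>n. norm (fps_nth F n * of_real s ^ n) * K)"
      by (rule summable_mult2[OF sF])
    show "norm (fps_nth (Abs_fps (\<lambda>n. fps_nth F n * fps_nth G n)) n * of_real r ^ n) \<le>
        norm (fps_nth F n * of_real s ^ n) * K" for n
      using mult_left_mono[OF K[of n], of "norm (fps_nth F n * of_real s ^ n)"]
      by (simp add: s(3) norm_mult power_mult_distrib mult_ac)
  qed
qed

lemma eball_1: "eball (0::complex) 1 = ball 0 1"
  by (metis eball_ereal one_ereal_def)

lemma fps_conv_radius_expansion_disc:
  "f holomorphic_on ball 0 1 \<Longrightarrow> fps_conv_radius (fps_expansion f 0) \<ge> 1"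
  using conv_radius_fps_expansion[of f 0 1] by (simp add: eball_1)

lemma has_fps_expansion_disc:
  "f holomorphic_on ball 0 1 \<Longrightarrow> f has_fps_expansion fps_expansion f 0"
  by (rule has_fps_expansion_fps_expansion[of "ball 0 1"]) auto

text \<open>Allows the parts chosen by \<open>SOME\<close> to be replaced by explicit ones, since
  \<open>analytic_conv\<close> sees only Taylor coefficients at 0.\<close>

lemma fps_expansion_cong_disc:
  assumes "\<And>z. z \<in> ball 0 1 \<Longrightarrow> f z = g z"
  shows "fps_expansion f 0 = fps_expansion g 0"
  by (rule fps_expansion_cong, rule eventually_nhds_in_open[THEN eventually_mono, of "ball 0 1"])
     (use assms in auto)

lemma has_fps_expansion_imp_sums_disc:
  fixes F :: "complex fps"
  assumes "f has_fps_expansion F" "f holomorphic_on ball 0 1" "norm z < 1"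
  shows "(\<lambda>n. fps_nth F n * z ^ n) sums f z"
  using has_fps_expansion_imp_sums_complex[of f F 1 z] assms by (simp add: eball_1)

lemma
  assumes "f holomorphic_on ball 0 1" "g holomorphic_on ball 0 1"
  defines "C \<equiv> Abs_fps (\<lambda>n. fps_nth (fps_expansion f 0) n * fps_nth (fps_expansion g 0) n)"
  shows holomorphic_analytic_conv: "analytic_conv f g holomorphic_on ball 0 1"
    and has_fps_expansion_analytic_conv: "analytic_conv f g has_fps_expansion C"
proof -
  have eq: "analytic_conv f g = eval_fps C"
    by (simp add: fun_eq_iff analytic_conv_def eval_fps_def C_def)
  have rad: "fps_conv_radius C \<ge> 1"
    unfolding C_def by (intro fps_conv_radius_hadamard fps_conv_radius_expansion_disc assms)
  show "analytic_conv f g has_fps_expansion C"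
    unfolding eq using rad by (intro eval_fps_has_fps_expansion) (auto intro: less_le_trans[of _ 1])
  show "analytic_conv f g holomorphic_on ball 0 1"
    unfolding eq using eball_mono[OF rad, of "0::complex"] by (intro holomorphic_on_eval_fps) (simp add: eball_1)
qed

lemma deriv_cong_disc:
  assumes "\<And>z. z \<in> ball 0 1 \<Longrightarrow> f z = g z" "z \<in> ball 0 1"
  shows "deriv f z = deriv g z"
  by (rule deriv_cong_ev, rule eventually_nhds_in_open[THEN eventually_mono, of "ball 0 1"])
     (use assms in auto)

text \<open>The two parts are chosen independently, each with its own partner; uniqueness on the
  disc shows that they fit together.\<close>

lemma harmonic_parts_some:
  assumes "harmonic_parts f h g"
  shows "harmonic_parts f (analytic_part f) (coanalytic_part f)"
proof -
  obtain g' where g': "harmonic_parts f (analytic_part f) g'"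
    using someI_ex[of "\<lambda>h. \<exists>g. harmonic_parts f h g"] assms unfolding analytic_part_def by blast
  obtain h' where h': "harmonic_parts f h' (coanalytic_part f)"
    using someI_ex[of "\<lambda>g. \<exists>h. harmonic_parts f h g"] assms unfolding coanalytic_part_def by blast
  show ?thesis
    using g' h' harmonic_parts_unique[OF g' h'] unfolding harmonic_parts_def by metis
qed

section \<open>The second-order operator under convolution\<close>

text \<open>The operator \<open>T\<close> of the overview. Keeping the constant of the class
  condition outside makes it linear in \<open>f\<close>, so it serves both parts; the condition on
  \<open>h\<close> then concerns \<open>second_order_op a h z - a\<close>.\<close>

definition second_order_op :: "complex \<Rightarrow> (complex \<Rightarrow> complex) \<Rightarrow> complex \<Rightarrow> complex" where
  "second_order_op a f z = z * deriv (deriv f) z + a * deriv f z"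

lemma holomorphic_second_order_op [holomorphic_intros]:
  assumes "f holomorphic_on S" "open S"
  shows "second_order_op a f holomorphic_on S"
  unfolding second_order_op_def using assms by (intro holomorphic_intros holomorphic_deriv) auto

text \<open>The coefficient at \<open>n\<close> involves \<open>F\<close> only at
  \<open>Suc n\<close>. Convolving with \<phi> hence multiplies it by the coefficient of \<phi> at
  \<open>Suc n\<close>, which is that of \<phi>(z)/z at \<open>n\<close>.\<close>

lemma has_fps_expansion_second_order_op:
  assumes "f has_fps_expansion F"
  shows "second_order_op a f has_fps_expansion
    Abs_fps (\<lambda>n. of_nat (Suc n) * (of_nat n + a) * fps_nth F (Suc n))"
proof -
  have "second_order_op a f has_fps_expansion fps_X * fps_deriv (fps_deriv F) + fps_const a * fps_deriv F"
    unfolding second_order_op_def by (intro fps_expansion_intros assms)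
  also have "fps_X * fps_deriv (fps_deriv F) + fps_const a * fps_deriv F =
      Abs_fps (\<lambda>n. of_nat (Suc n) * (of_nat n + a) * fps_nth F (Suc n))"
  proof (rule fps_ext)
    fix n
    show "fps_nth (fps_X * fps_deriv (fps_deriv F) + fps_const a * fps_deriv F) n =
        fps_nth (Abs_fps (\<lambda>n. of_nat (Suc n) * (of_nat n + a) * fps_nth F (Suc n))) n"
      by (cases n) (simp_all add: algebra_simps)
  qed
  finally show ?thesis .
qed

lemma second_order_op_conv_bound:
  assumes h: "h holomorphic_on ball 0 1" "deriv h 0 = 1"
    and g: "g holomorphic_on ball 0 1" "deriv g 0 = 0"
    and bound: "\<And>z. z \<in> ball 0 1 \<Longrightarrow>
      norm (second_order_op a h z - a) \<le> B - norm (second_order_op a g z)"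
    and \<phi>: "\<phi> \<in> convex_class_K" and \<mu>: "norm \<mu> = 1" and z: "norm z < 1"
  shows "norm (second_order_op a (analytic_conv h \<phi>) z - a) \<le>
    B - norm (second_order_op a (analytic_conv g (\<lambda>z. \<mu> * \<phi> z)) z)"
proof -
  let ?co = "\<lambda>f n. fps_nth (fps_expansion f 0) n"
  let ?g' = "analytic_conv g (\<lambda>z. \<mu> * \<phi> z)"
  have \<phi>': "\<phi> holomorphic_on ball 0 1" "inj_on \<phi> (ball 0 1)" "\<phi> 0 = 0" "deriv \<phi> 0 = 1"
      "convex (\<phi> ` ball 0 1)"
    using \<phi> by (auto simp: convex_class_K_def)
  have \<mu>\<phi>: "(\<lambda>z. \<mu> * \<phi> z) holomorphic_on ball 0 1"
    by (intro holomorphic_intros \<phi>')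
  have co_\<mu>\<phi>: "?co (\<lambda>z. \<mu> * \<phi> z) n = \<mu> * ?co \<phi> n" for n
  proof -
    have "(\<lambda>z. \<mu> * \<phi> z) has_fps_expansion fps_const \<mu> * fps_expansion \<phi> 0"
      by (intro fps_expansion_intros has_fps_expansion_disc \<phi>')
    from fps_expansion_eqI[OF this] show ?thesis by simp
  qed
  have co1: "?co f (Suc 0) = deriv f 0" for f
    by (simp add: fps_expansion_def)
  define A where "A = second_order_op a (analytic_conv h \<phi>) z - a"
  define D where "D = second_order_op a ?g' z"
  have bd: "norm (A + e * D) \<le> B" if e: "norm e = 1" for e
  proof -
    define P where "P w = second_order_op a h w - a + e * \<mu> * second_order_op a g w" for w
    \<comment> \<open>The constant \<open>a\<close> is subtracted at index 0 only, where
      \<open>p 0 = deriv \<phi> 0 = 1\<close>, so it passes through the Hadamard product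
      unchanged.\<close>
    define c where "c n = of_nat (Suc n) * (of_nat n + a) * ?co h (Suc n) - (if n = 0 then a else 0) +
      e * \<mu> * (of_nat (Suc n) * (of_nat n + a) * ?co g (Suc n))" for n
    define p where "p n = ?co \<phi> (Suc n)" for n
    \<comment> \<open>The function \<phi>(w)/w, with its removable singularity filled by
      \<open>deriv \<phi> 0 = 1\<close>.\<close>
    define q where "q w = (if w = 0 then 1 else \<phi> w / w)" for w
    have "norm (\<Sum>n. c n * p n * z ^ n) \<le> B"
    proof (rule hadamard_product_bound[where P = P and q = q])
      fix w :: complex assume w: "norm w < 1"
      have "P has_fps_expansion Abs_fps c"
      proof -
        have "P has_fps_expansion
            Abs_fps (\<lambda>n. of_nat (Suc n) * (of_nat n + a) * ?co h (Suc n)) - fps_const a +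
            fps_const (e * \<mu>) * Abs_fps (\<lambda>n. of_nat (Suc n) * (of_nat n + a) * ?co g (Suc n))"
          unfolding P_def
          by (intro fps_expansion_intros has_fps_expansion_second_order_op has_fps_expansion_disc h g)
        also have "\<dots> = Abs_fps c"
          by (rule fps_ext) (simp add: c_def)
        finally show ?thesis .
      qed
      moreover have "P holomorphic_on ball 0 1"
        unfolding P_def by (intro holomorphic_intros h g) auto
      ultimately show "(\<lambda>n. c n * w ^ n) sums P w"
        using has_fps_expansion_imp_sums_disc[of P "Abs_fps c" w] w by simp
      have "norm (P w) \<le> norm (second_order_op a h w - a) + norm (second_order_op a g w)"
        unfolding P_def using norm_triangle_ineq[of "second_order_op a h w - a"
            "e * \<mu> * second_order_op a g w"] e \<mu> by (simp add: norm_mult)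
      also have "\<dots> \<le> B"
        using bound[of w] w by simp
      finally show "norm (P w) \<le> B" .
      show "(\<lambda>n. p n * w ^ n) sums q w"
      proof (cases "w = 0")
        case True
        then show ?thesis
          using powser_sums_zero[of p] by (simp add: q_def p_def co1 \<phi>')
      next
        case False
        have "(\<lambda>n. ?co \<phi> n * w ^ n) sums \<phi> w"
          by (intro has_fps_expansion_imp_sums_disc has_fps_expansion_disc \<phi>' w)
        then have "(\<lambda>n. ?co \<phi> (Suc n) * w ^ Suc n) sums \<phi> w"
          by (subst sums_Suc_iff) (simp add: fps_expansion_def \<phi>')
        from sums_divide[OF this, of w] show ?thesis
          using False by (simp add: q_def p_def)
      qed
      show "Re (q w) \<ge> 1 / 2"
        using convex_Re_div_ge_half[OF \<phi>'(1,2,5,3,4), of w] w by (auto simp: q_def)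
    qed (auto simp: p_def co1 \<phi>' z)
    also have "(\<Sum>n. c n * p n * z ^ n) = A + e * D"
    proof (rule sums_unique[symmetric])
      define G where "G w = second_order_op a (analytic_conv h \<phi>) w - a + e * second_order_op a ?g' w" for w
      have "G has_fps_expansion Abs_fps (\<lambda>n. c n * p n)"
      proof -
        have "G has_fps_expansion
            Abs_fps (\<lambda>n. of_nat (Suc n) * (of_nat n + a) *
              fps_nth (Abs_fps (\<lambda>n. ?co h n * ?co \<phi> n)) (Suc n)) - fps_const a +
            fps_const e * Abs_fps (\<lambda>n. of_nat (Suc n) * (of_nat n + a) *
              fps_nth (Abs_fps (\<lambda>n. ?co g n * ?co (\<lambda>z. \<mu> * \<phi> z) n)) (Suc n))"
          unfolding G_def
          by (intro fps_expansion_intros has_fps_expansion_second_order_op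
              has_fps_expansion_analytic_conv h g \<phi>' \<mu>\<phi>)
        also have "\<dots> = Abs_fps (\<lambda>n. c n * p n)"
          by (rule fps_ext) (simp add: c_def p_def co1 co_\<mu>\<phi> \<phi>' algebra_simps)
        finally show ?thesis .
      qed
      moreover have "G holomorphic_on ball 0 1"
        unfolding G_def by (intro holomorphic_intros holomorphic_analytic_conv h g \<phi>' \<mu>\<phi>) auto
      ultimately show "(\<lambda>n. c n * p n * z ^ n) sums (A + e * D)"
        using has_fps_expansion_imp_sums_disc[of G "Abs_fps (\<lambda>n. c n * p n)" z] z
        by (simp add: G_def A_def D_def)
    qed
    finally show ?thesis .
  qed
  have "norm A + norm D \<le> B"
  proof (cases "A = 0 \<or> D = 0")
    case True
    then show ?thesis using bd[of 1] by auto
  next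
    case False
    \<comment> \<open>This factor rotates \<open>D\<close> into the direction of \<open>A\<close>,
      giving equality in the triangle inequality.\<close>
    define e where "e = sgn A / sgn D"
    have e: "norm e = 1"
      using False by (simp add: e_def norm_divide norm_sgn)
    have eD: "e * D = sgn A * of_real (norm D)"
      using False unfolding e_def sgn_eq by (simp add: field_simps)
    have "A + e * D = sgn A * of_real (norm A + norm D)"
      unfolding eD using False by (simp add: ring_distribs) (simp add: sgn_eq)
    then have "norm (A + e * D) = norm A + norm D"
      using False by (simp only: norm_mult norm_of_real norm_sgn) simp
    with bd[OF e] show ?thesis by simp
  qed
  then show ?thesis
    by (simp add: A_def D_def)
qed

section \<open>Closure of the harmonic class under convolution\<close>

theorem theorem2p8:
  fixes \<alpha> \<beta> :: real and f \<phi> :: "complex \<Rightarrow> complex"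
  assumes "\<alpha> > -1" and "\<beta> > 0"
    and "f \<in> harmonic_class_B0 \<alpha> \<beta>" and "\<phi> \<in> convex_class_K"
  shows "\<forall>\<mu>::complex. cmod \<mu> = 1 \<longrightarrow>
    harmonic_conv f (\<lambda>z. \<phi> z + \<mu> * cnj (\<phi> z)) \<in> harmonic_class_B0 \<alpha> \<beta>"
proof (intro allI impI)
  fix \<mu> :: complex assume \<mu>: "cmod \<mu> = 1"
  define F where "F z = \<phi> z + \<mu> * cnj (\<phi> z)" for z
  have \<phi>: "\<phi> holomorphic_on ball 0 1" "\<phi> 0 = 0" "deriv \<phi> 0 = 1"
    using assms(4) by (auto simp: convex_class_K_def)
  have \<mu>\<phi>: "(\<lambda>z. cnj \<mu> * \<phi> z) holomorphic_on ball 0 1"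
    by (intro holomorphic_intros \<phi>)
  \<comment> \<open>The scalar is conjugated because the co-analytic part enters through its
    conjugate.\<close>
  have F: "harmonic_parts F \<phi> (\<lambda>z. cnj \<mu> * \<phi> z)"
    using \<phi> \<mu>\<phi> by (simp add: harmonic_parts_def F_def)
  obtain h g where hg: "harmonic_parts f h g" "deriv h 0 = 1" "deriv g 0 = 0"
    using assms(3) by (auto simp: harmonic_class_B0_def harmonic_class_H0_def)
  obtain h' g' where hg': "harmonic_parts f h' g'"
      and bound': "\<And>z. z \<in> ball 0 1 \<Longrightarrow>
        cmod (z * deriv (deriv h') z + of_real \<alpha> * (deriv h' z - 1))
          \<le> \<beta> - cmod (z * deriv (deriv g') z + of_real \<alpha> * deriv g' z)"
    using assms(3) by (auto simp: harmonic_class_B0_def)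
  \<comment> \<open>The class definitions supply one decomposition with the normalisation and
    another with the bound. Uniqueness, passed on to the first and second derivatives, moves the
    bound to \<open>h\<close> and \<open>g\<close>.\<close>
  note eq = harmonic_parts_unique[OF hg(1) hg']
  have holh: "h holomorphic_on ball 0 1" and holg: "g holomorphic_on ball 0 1"
    and h0: "h 0 = 0" and g0: "g 0 = 0"
    using hg(1) by (auto simp: harmonic_parts_def)
  have deq: "deriv h z = deriv h' z" "deriv g z = deriv g' z" if "z \<in> ball 0 1" for z
    by (rule deriv_cong_disc[OF _ that], fact eq)+
  have ddeq: "deriv (deriv h) z = deriv (deriv h') z" "deriv (deriv g) z = deriv (deriv g') z"
    if "z \<in> ball 0 1" for z
    by (rule deriv_cong_disc[OF _ that], fact deq)+
  have bound: "norm (second_order_op \<alpha> h z - \<alpha>) \<le> \<beta> - norm (second_order_op \<alpha> g z)"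
    if "z \<in> ball 0 1" for z
    using bound'[OF that] by (simp add: second_order_op_def deq[OF that] ddeq[OF that] algebra_simps)
  let ?h = "analytic_conv h \<phi>" and ?g = "analytic_conv g (\<lambda>z. cnj \<mu> * \<phi> z)"
  have parts_conv: "analytic_conv (analytic_part f) (analytic_part F) = ?h"
      "analytic_conv (coanalytic_part f) (coanalytic_part F) = ?g"
    using fps_expansion_cong_disc[OF harmonic_parts_unique(1)[OF harmonic_parts_some[OF hg(1)] hg(1)]]
      fps_expansion_cong_disc[OF harmonic_parts_unique(2)[OF harmonic_parts_some[OF hg(1)] hg(1)]]
      fps_expansion_cong_disc[OF harmonic_parts_unique(1)[OF harmonic_parts_some[OF F] F]]
      fps_expansion_cong_disc[OF harmonic_parts_unique(2)[OF harmonic_parts_some[OF F] F]]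
    by (simp_all add: fun_eq_iff analytic_conv_def)
  have nth: "fps_nth (fps_expansion f 0) 0 = f 0" "fps_nth (fps_expansion f 0) 1 = deriv f 0" for f
    by (simp_all add: fps_expansion_def)
  note expansion_h = fps_expansion_eqI[OF has_fps_expansion_analytic_conv[OF holh \<phi>(1)]]
  note expansion_g = fps_expansion_eqI[OF has_fps_expansion_analytic_conv[OF holg \<mu>\<phi>]]
  have parts: "harmonic_parts (harmonic_conv f F) ?h ?g"
    unfolding harmonic_parts_def
    using nth(1)[of ?h] nth(1)[of ?g] nth(1)[of h] nth(1)[of g] h0 g0
    by (auto simp: harmonic_conv_def parts_conv holomorphic_analytic_conv holh holg \<phi> \<mu>\<phi>
        expansion_h expansion_g)
  have "deriv ?h 0 = 1" "deriv ?g 0 = 0"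
    using nth(2)[of ?h] nth(2)[of ?g] nth(2)[of h] nth(2)[of g] nth(2)[of \<phi>] hg \<phi>
    by (simp_all add: expansion_h expansion_g)
  moreover have "cmod (z * deriv (deriv ?h) z + of_real \<alpha> * (deriv ?h z - 1))
      \<le> \<beta> - cmod (z * deriv (deriv ?g) z + of_real \<alpha> * deriv ?g z)" if "z \<in> ball 0 1" for z
    using second_order_op_conv_bound[OF holh hg(2) holg hg(3) bound assms(4), of "cnj \<mu>" z] \<mu> that
    by (simp add: second_order_op_def algebra_simps)
  ultimately have "harmonic_conv f F \<in> harmonic_class_B0 \<alpha> \<beta>"
    using parts unfolding harmonic_class_B0_def harmonic_class_H0_def by blast
  then show "harmonic_conv f (\<lambda>z. \<phi> z + \<mu> * cnj (\<phi> z)) \<in> harmonic_class_B0 \<alpha> \<beta>"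
    by (simp add: F_def[abs_def])
qed

end
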